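(* Let $X$ be a real vector space, $C, D \subseteq X$ convex sets and $L \subseteq X$ an affine flat. The following statements 1 and 2 are equivalent (and in this case $L$ is called a separating flat of $C$ and $D$): 1. $L = \gamma_1^{-1}(U)$ for some separating subspace $U$ of $K := \operatorname{cone}(C \times \{1\})$ and $G := \operatorname{cone}(D \times \{1\})$ (convex cones in $X \times \mathbb{R}$). 2. $L = \ker f$ for some oriented affine map $f: X \to (Y, Y_+)$ separating $C$ from $D$. If $C \cap D \neq \varnothing$, then each of the following statements 3 and 4 is also equivalent to statements 1 and 2: 3. $L$ is a supporting flat of both $C$ and $D$, and for all $c \in C$, $d \in D$: $c - d \in L - L \implies c, d \in L$. 4. $L = \tilde{L} + C \cap D$ (Minkowski sum) for some supporting subspace $\tilde{L}$ of $\operatorname{cone}(C-D)$.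
   Context: Vector spaces are real, of arbitrary (possibly infinite) dimension, with no topology. An affine flat is a translate of a linear subspace, or the empty set (the kernel of an affine map may be empty). A convex cone contains the origin and is closed under addition and under multiplication by positive scalars; it is pointed if $K \cap (-K) = \{0\}$. $\operatorname{cone}(S) := \{\lambda s \mid \lambda \ge 0, s \in S\}$, with the convention $\operatorname{cone}(\varnothing) = \{0\}$. $\gamma_1: X \to X \times \mathbb{R}$ is $\gamma_1(x) := (x,1)$. An oriented linear (resp. affine) map $f: W \to (Y,Y_+)$ is a linear (resp. affine) map from a real vector space $W$ to a real vector space $Y$ equipped with a pointed convex cone $Y_+ \subseteq Y$ (defining the partial order $y \le y' \iff y'-y \in Y_+$); it is positive on $S$ if $f(S) \subseteq Y_+$; $\ker f := f^{-1}(0)$. Inequalities between sets are elementwise. $A - B := \{a - b \mid a \in A, b \in B\}$. A supporting subspace of a convex cone $K \subseteq W$ is $\ker\psi$ for an oriented linear map $\psi$ on $W$ positive on $K$. A supporting flat of a convex set $C \subseteq X$ is $\ker f$ for an oriented affine map $f$ on $X$ positive on $C$. A separating subspace of convex cones $K, G \subseteq W$ is $\ker \psi$ for an oriented linear map $\psi: W \to (Y,Y_+)$ with $\psi(G) \le \psi(K)$. An oriented affine map $f$ separates $C$ from $D$ if $f(D) \le 0 \le f(C)$.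
   Formalization: Statement 3 is stated with the added requirement that L is nonempty: the empty flat is a supporting flat of both C and D and satisfies the implication vacuously, yet it is never a separating flat when C and D meet. *)

theory Defs
  imports "HOL-Analysis.Analysis"
begin

text \<open>The library's \<^const>\<open>cone\<close> is a predicate and its cone hull of the empty set is empty;
  here the cone generated by the empty set is the zero cone. The set difference \<open>A - B\<close>
  of HOL is not the elementwise one, whereas \<open>A + B\<close> on sets (\<^theory>\<open>HOL-Library.Set_Algebras\<close>)
  is the Minkowski sum.\<close>

definition cone_of :: "'a::real_vector set \<Rightarrow> 'a set" where
  "cone_of S = (if S = {} then {0} else {t *\<^sub>R s | t s. 0 \<le> t \<and> s \<in> S})"

definition minkowski_diff :: "'a::real_vector set \<Rightarrow> 'a set \<Rightarrow> 'a set" where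
  "minkowski_diff A B = {a - b | a b. a \<in> A \<and> b \<in> B}"

definition gamma1 :: "'a::real_vector \<Rightarrow> 'a \<times> real" where
  "gamma1 x = (x, 1)"

definition pointed :: "'a::real_vector set \<Rightarrow> bool" where
  "pointed K \<longleftrightarrow> K \<inter> uminus ` K = {0}"

definition cone_le :: "'a::real_vector set \<Rightarrow> 'a \<Rightarrow> 'a \<Rightarrow> bool" where
  "cone_le P y y' \<longleftrightarrow> y' - y \<in> P"

definition affine_map :: "('a::real_vector \<Rightarrow> 'b::real_vector) \<Rightarrow> bool" where
  "affine_map f \<longleftrightarrow> (\<exists>l c. linear l \<and> f = (\<lambda>x. l x + c))"

definition oriented_linear :: "('a::real_vector \<Rightarrow> 'b::real_vector) \<Rightarrow> 'b set \<Rightarrow> bool" where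
  "oriented_linear f P \<longleftrightarrow> linear f \<and> convex_cone P \<and> pointed P"

definition oriented_affine :: "('a::real_vector \<Rightarrow> 'b::real_vector) \<Rightarrow> 'b set \<Rightarrow> bool" where
  "oriented_affine f P \<longleftrightarrow> affine_map f \<and> convex_cone P \<and> pointed P"

definition positive_on :: "('a \<Rightarrow> 'b) \<Rightarrow> 'b set \<Rightarrow> 'a set \<Rightarrow> bool" where
  "positive_on f P S \<longleftrightarrow> f ` S \<subseteq> P"

definition separates :: "('a \<Rightarrow> 'b::real_vector) \<Rightarrow> 'b set \<Rightarrow> 'a set \<Rightarrow> 'a set \<Rightarrow> bool" where
  "separates f P C D \<longleftrightarrow> (\<forall>d\<in>D. cone_le P (f d) 0) \<and> (\<forall>c\<in>C. cone_le P 0 (f c))"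

definition ker :: "('a \<Rightarrow> 'b::zero) \<Rightarrow> 'a set" where
  "ker f = f -` {0}"

text \<open>The following notions ask for an oriented map into some ordered vector space \<open>(Y, Y\<^sub>+)\<close>.
  HOL cannot quantify over the type \<open>Y\<close>, so the definitions use the codomain \<open>W \<times> \<real>\<close>. This
  loses nothing: the linear hull of the image of an affine map on \<open>W\<close> embeds into
  \<open>W \<times> \<real>\<close>. The lemmas \<open>supporting_subspaceI\<close>, \<open>supporting_flatI\<close>, \<open>separating_subspaceI\<close>
  and \<open>separating_flatI\<close> below show that maps into arbitrary types give the same notions.\<close>

definition supporting_subspace :: "'w::real_vector set \<Rightarrow> 'w set \<Rightarrow> bool" where
  "supporting_subspace K S \<longleftrightarrow>
    (\<exists>(\<psi> :: 'w \<Rightarrow> 'w \<times> real) P. oriented_linear \<psi> P \<and> positive_on \<psi> P K \<and> S = ker \<psi>)"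

definition supporting_flat :: "'w::real_vector set \<Rightarrow> 'w set \<Rightarrow> bool" where
  "supporting_flat C S \<longleftrightarrow>
    (\<exists>(f :: 'w \<Rightarrow> 'w \<times> real) P. oriented_affine f P \<and> positive_on f P C \<and> S = ker f)"

definition separating_subspace :: "'w::real_vector set \<Rightarrow> 'w set \<Rightarrow> 'w set \<Rightarrow> bool" where
  "separating_subspace K G S \<longleftrightarrow>
    (\<exists>(\<psi> :: 'w \<Rightarrow> 'w \<times> real) P. oriented_linear \<psi> P \<and>
       (\<forall>g\<in>G. \<forall>k\<in>K. cone_le P (\<psi> g) (\<psi> k)) \<and> S = ker \<psi>)"

definition separating_flat :: "'w::real_vector set \<Rightarrow> 'w set \<Rightarrow> 'w set \<Rightarrow> bool" where
  "separating_flat C D S \<longleftrightarrow>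
    (\<exists>(f :: 'w \<Rightarrow> 'w \<times> real) P. oriented_affine f P \<and> separates f P C D \<and> S = ker f)"

lemma affine_map_linear: "linear f \<Longrightarrow> affine_map f"
  unfolding affine_map_def by (rule exI[of _ f], rule exI[of _ 0]) simp

lemma oriented_affine_transfer:
  fixes f :: "'w::real_vector \<Rightarrow> 'y::real_vector"
  assumes "oriented_affine f P"
  obtains g :: "'w \<Rightarrow> 'w \<times> real" and Q where
    "oriented_affine g Q" "linear f \<Longrightarrow> linear g"
    "\<And>x. g x \<in> Q \<longleftrightarrow> f x \<in> P" "\<And>x. - g x \<in> Q \<longleftrightarrow> - f x \<in> P"
    "\<And>x y. g x - g y \<in> Q \<longleftrightarrow> f x - f y \<in> P" "ker g = ker f"
proof -
  from assms obtain l c where l: "linear l" and f: "f = (\<lambda>x. l x + c)"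
    and P: "convex_cone P" "pointed P"
    unfolding oriented_affine_def affine_map_def by blast
  define F :: "'w \<times> real \<Rightarrow> 'y" where "F = (\<lambda>(w, t). l w + t *\<^sub>R c)"
  have F: "linear F"
    unfolding F_def
    by (rule linearI) (auto simp: linear_add[OF l] linear_scale[OF l] algebra_simps)
  obtain h where h: "linear h" and hF: "\<And>v. v \<in> range F \<Longrightarrow> F (h v) = v"
    using real_vector.linear_exists_right_inverse_on[OF F subspace_UNIV] by blast
  have sub: "subspace (range F)"
    using linear_subspace_image[OF F subspace_UNIV] .
  have fr: "f x \<in> range F" for x
  proof -
    have "f x = F (x, 1)" by (simp add: F_def f)
    then show ?thesis by simp
  qed
  define Q where "Q = h ` (P \<inter> range F)"
  define g where "g = h \<circ> f"
  have inQ: "h v \<in> Q \<longleftrightarrow> v \<in> P" if "v \<in> range F" for v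
  proof
    assume "h v \<in> Q"
    then obtain u where "u \<in> P" "u \<in> range F" "h v = h u" unfolding Q_def by blast
    then show "v \<in> P" using hF[of u] hF[OF that] by simp
  qed (use that in \<open>simp add: Q_def\<close>)
  have h0: "h v = 0 \<longleftrightarrow> v = 0" if "v \<in> range F" for v
  proof
    assume "h v = 0"
    then show "v = 0" using hF[OF that] linear_0[OF F] by simp
  qed (simp add: linear_0[OF h])
  have "convex_cone (P \<inter> range F)"
    using P(1) sub subspace_add subspace_scale subspace_0 unfolding convex_cone_iff by blast
  then have Qc: "convex_cone Q"
    unfolding Q_def using convex_cone_linear_image h by blast
  have "x = 0" if x: "x \<in> Q" "- x \<in> Q" for x
  proof -
    from x(1) obtain v where v: "v \<in> P" "v \<in> range F" "x = h v"
      unfolding Q_def by blast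
    have "- v \<in> range F" using sub v(2) subspace_neg by blast
    then have "- v \<in> P" using inQ x(2) v(3) by (simp add: linear_neg[OF h] flip: inQ)
    then have "v \<in> P \<inter> uminus ` P" using v(1) by (auto intro: rev_image_eqI)
    then have "v = 0" using P(2) unfolding pointed_def by blast
    then show ?thesis using v(3) linear_0[OF h] by simp
  qed
  then have Qp: "pointed Q"
    using Qc unfolding pointed_def convex_cone_iff by force
  have "affine_map g"
    unfolding affine_map_def
    by (intro exI[of _ "h \<circ> l"] exI[of _ "h c"])
      (auto simp: linear_compose[OF l h] g_def f linear_add[OF h])
  then have 1: "oriented_affine g Q"
    using Qc Qp unfolding oriented_affine_def by blast
  have 2: "linear g" if "linear f"
    unfolding g_def using linear_compose[OF that h] .
  have 3: "g x \<in> Q \<longleftrightarrow> f x \<in> P" for x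
    unfolding g_def using inQ[OF fr] by simp
  have 4: "- g x \<in> Q \<longleftrightarrow> - f x \<in> P" for x
    using inQ[OF subspace_neg[OF sub fr]] by (simp add: g_def linear_neg[OF h])
  have 5: "g x - g y \<in> Q \<longleftrightarrow> f x - f y \<in> P" for x y
    using inQ[OF subspace_diff[OF sub fr fr]] by (simp add: g_def linear_diff[OF h])
  have 6: "ker g = ker f"
    unfolding ker_def g_def using h0[OF fr] linear_0[OF h] by auto
  show ?thesis using that[OF 1 2 3 4 5 6] .
qed

lemma supporting_subspaceI:
  fixes \<psi> :: "'w::real_vector \<Rightarrow> 'y::real_vector"
  assumes "oriented_linear \<psi> P" "positive_on \<psi> P K"
  shows "supporting_subspace K (ker \<psi>)"
proof -
  have "oriented_affine \<psi> P" and lin: "linear \<psi>"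
    using assms(1) affine_map_linear by (auto simp: oriented_linear_def oriented_affine_def)
  from oriented_affine_transfer[OF this(1)] obtain g :: "'w \<Rightarrow> 'w \<times> real" and Q where
    "oriented_affine g Q" "linear g" "\<And>x. g x \<in> Q \<longleftrightarrow> \<psi> x \<in> P" "ker g = ker \<psi>"
    using lin by metis
  then show ?thesis
    using assms(2) unfolding supporting_subspace_def positive_on_def
    by (intro exI[of _ g] exI[of _ Q]) (auto simp: oriented_linear_def oriented_affine_def)
qed

lemma supporting_flatI:
  fixes f :: "'w::real_vector \<Rightarrow> 'y::real_vector"
  assumes "oriented_affine f P" "positive_on f P C"
  shows "supporting_flat C (ker f)"
proof -
  from oriented_affine_transfer[OF assms(1)] obtain g :: "'w \<Rightarrow> 'w \<times> real" and Q where
    "oriented_affine g Q" "\<And>x. g x \<in> Q \<longleftrightarrow> f x \<in> P" "ker g = ker f"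
    by metis
  then show ?thesis
    using assms(2) unfolding supporting_flat_def positive_on_def
    by (intro exI[of _ g] exI[of _ Q]) auto
qed

lemma separating_subspaceI:
  fixes \<psi> :: "'w::real_vector \<Rightarrow> 'y::real_vector"
  assumes "oriented_linear \<psi> P" "\<forall>g\<in>G. \<forall>k\<in>K. cone_le P (\<psi> g) (\<psi> k)"
  shows "separating_subspace K G (ker \<psi>)"
proof -
  have "oriented_affine \<psi> P" and lin: "linear \<psi>"
    using assms(1) affine_map_linear by (auto simp: oriented_linear_def oriented_affine_def)
  from oriented_affine_transfer[OF this(1)] obtain g :: "'w \<Rightarrow> 'w \<times> real" and Q where
    "oriented_affine g Q" "linear g" "\<And>x y. g x - g y \<in> Q \<longleftrightarrow> \<psi> x - \<psi> y \<in> P" "ker g = ker \<psi>"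
    using lin by metis
  then show ?thesis
    using assms(2) unfolding separating_subspace_def cone_le_def
    by (intro exI[of _ g] exI[of _ Q]) (auto simp: oriented_linear_def oriented_affine_def)
qed

lemma separating_flatI:
  fixes f :: "'w::real_vector \<Rightarrow> 'y::real_vector"
  assumes "oriented_affine f P" "separates f P C D"
  shows "separating_flat C D (ker f)"
proof -
  from oriented_affine_transfer[OF assms(1)] obtain g :: "'w \<Rightarrow> 'w \<times> real" and Q where
    "oriented_affine g Q" "\<And>x. g x \<in> Q \<longleftrightarrow> f x \<in> P" "\<And>x. - g x \<in> Q \<longleftrightarrow> - f x \<in> P" "ker g = ker f"
    by metis
  then show ?thesis
    using assms(2) unfolding separating_flat_def separates_def cone_le_def
    by (intro exI[of _ g] exI[of _ Q]) auto
qed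

text \<open>The empty flat supports every set (it is the kernel of a positive constant), and no points
  satisfy \<open>c - d \<in> \<emptyset> - \<emptyset>\<close>. It therefore satisfies the supporting-flat criterion vacuously for all
  \<open>C\<close> and \<open>D\<close>, although it separates no two sets that meet. The criterion has to be read
  for nonempty flats.\<close>

lemma supporting_flat_empty: "supporting_flat C {}"
proof -
  have "affine_map (\<lambda>_. 1 :: real)"
    unfolding affine_map_def by (rule exI[of _ "\<lambda>_. 0"], rule exI[of _ 1]) (simp add: module_hom_zero)
  moreover have "convex_cone {0::real..}" "pointed {0::real..}"
    by (auto simp: convex_cone_iff pointed_def)
  ultimately have "supporting_flat C (ker (\<lambda>_::'a. 1 :: real))"
    by (intro supporting_flatI[where P = "{0..}"]) (auto simp: oriented_affine_def positive_on_def)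
  then show ?thesis by (simp add: ker_def)
qed

lemma not_separating_flat_empty:
  assumes "C \<inter> D \<noteq> {}"
  shows "\<not> separating_flat C D {}"
proof
  assume "separating_flat C D {}"
  then obtain f :: "'a \<Rightarrow> 'a \<times> real" and P where
    P: "pointed P" and s: "separates f P C D" and k: "ker f = {}"
    unfolding separating_flat_def oriented_affine_def by blast
  from assms obtain e where e: "e \<in> C" "e \<in> D" by blast
  then have "f e \<in> P" "- f e \<in> P"
    using s by (auto simp: separates_def cone_le_def)
  then have "f e \<in> P \<inter> uminus ` P" by (auto intro: rev_image_eqI)
  then have "e \<in> ker f" using P by (auto simp: pointed_def ker_def)
  then show False using k by blast
qed

end

theory Submission
  imports Defs
begin

text \<open>For two sets that meet, every separating map vanishes on \<open>C \<inter> D\<close>, so an affine map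
  separating \<open>C\<close> from \<open>D\<close> is a translate of a linear map that is positive on \<open>C - D\<close>. For the
  converse from the supporting-flat criterion, the linear part \<open>l\<close> of the map supporting \<open>C\<close> is
  kept and its codomain gets a new order, with positive cone \<open>l (cone (C - D))\<close>. The criterion says
  that this cone is pointed: two opposite nonzero elements \<open>l (s (c - d))\<close> and
  \<open>l (t (c' - d'))\<close> yield convex combinations of \<open>c, c'\<close> and of \<open>d, d'\<close> lying in \<open>L\<close>; since
  \<open>C \<inter> L\<close> and \<open>D \<inter> L\<close> are faces of \<open>C\<close> and \<open>D\<close>, all four points lie in \<open>L\<close>, a contradiction.\<close>

section \<open>Pointed cones and generated cones\<close>

lemma pointedD:
  assumes "pointed P" "x \<in> P" "- x \<in> P"
  shows "x = 0"
proof -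
  have "x \<in> P \<inter> uminus ` P" using assms(2,3) by (auto intro: rev_image_eqI)
  then show ?thesis using assms(1) unfolding pointed_def by blast
qed

lemma convex_cone_pointedI:
  assumes "convex_cone P" "\<And>x. x \<in> P \<Longrightarrow> - x \<in> P \<Longrightarrow> x = 0"
  shows "pointed P"
  using assms unfolding pointed_def convex_cone_iff by force

text \<open>Each scaled summand is the negative of the other, so both lie in \<open>P\<close>
  together with their negatives and vanish. \<open>supporting_flat_face\<close> uses pointedness in
  this form.\<close>

lemma pointed_sum_zeroD:
  assumes P: "convex_cone P" "pointed P" and "x \<in> P" "y \<in> P" and "s > 0" "t > 0"
    and eq: "s *\<^sub>R x + t *\<^sub>R y = 0"
  shows "x = 0 \<and> y = 0"
proof -
  have "s *\<^sub>R x \<in> P" "t *\<^sub>R y \<in> P"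
    using assms unfolding convex_cone_iff by auto
  moreover have "t *\<^sub>R y = - (s *\<^sub>R x)" using eq by (simp add: eq_neg_iff_add_eq_0 add.commute)
  ultimately have "s *\<^sub>R x = 0" using pointedD[OF P(2)] by metis
  then show ?thesis using eq \<open>s > 0\<close> \<open>t > 0\<close> by simp
qed

lemma zero_in_cone_of: "0 \<in> cone_of S"
  unfolding cone_of_def by (auto intro!: exI[of _ "0::real"])

lemma subset_cone_of: "s \<in> S \<Longrightarrow> s \<in> cone_of S"
  unfolding cone_of_def by (auto intro!: exI[of _ "1::real"] exI[of _ s])

text \<open>Generators suffice because \<open>P\<close> is closed under nonnegative scaling; the
  value at 0 covers the empty generating set.\<close>

lemma cone_of_image_subset:
  assumes "linear \<psi>" "convex_cone P" "\<And>s. s \<in> S \<Longrightarrow> \<psi> s \<in> P" "x \<in> cone_of S"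
  shows "\<psi> x \<in> P"
  using assms unfolding cone_of_def convex_cone_iff
  by (auto simp: linear_0 linear_scale split: if_splits)

text \<open>For nonempty \<open>S\<close> this is the conic hull, whose convexity carries over; the
  empty set has an empty conic hull and is a separate case.\<close>

lemma convex_cone_cone_of:
  assumes "convex S"
  shows "convex_cone (cone_of S)"
proof (cases "S = {}")
  case True
  then show ?thesis by (simp add: cone_of_def convex_cone_iff)
next
  case False
  then have "cone_of S = conic hull S"
    by (simp add: cone_of_def conic_hull_explicit)
  then show ?thesis
    using assms zero_in_cone_of[of S] unfolding convex_cone_def
    by (metis conic_conic_hull convex_conic_hull empty_iff)
qed

section \<open>Difference sets and kernels of affine maps\<close>

lemma convex_minkowski_diff:
  assumes "convex C" "convex D"
  shows "convex (minkowski_diff C D)"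
proof -
  have "minkowski_diff C D = (\<Union>x\<in>C. \<Union>y\<in>D. {x - y})"
    unfolding minkowski_diff_def by auto
  then show ?thesis using convex_differences[OF assms] by simp
qed

text \<open>A zero \<open>e\<close> of the affine map gives \<open>v = (v + e) - e\<close> for every
  \<open>v\<close> in \<open>ker l\<close>. Membership of \<open>c - d\<close> in
  \<open>L - L\<close> thereby becomes \<open>l c = l d\<close>.\<close>

lemma minkowski_diff_ker:
  assumes l: "linear l" and "ker (\<lambda>x. l x + b) \<noteq> {}"
  shows "minkowski_diff (ker (\<lambda>x. l x + b)) (ker (\<lambda>x. l x + b)) = ker l"
proof -
  obtain e where "l e + b = 0" using assms(2) by (auto simp: ker_def)
  then have "v \<in> minkowski_diff (ker (\<lambda>x. l x + b)) (ker (\<lambda>x. l x + b))" if "l v = 0" for v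
    using that unfolding minkowski_diff_def ker_def mem_Collect_eq
    by (intro exI[of _ "v + e"] exI[of _ e]) (auto simp: linear_add[OF l] add.assoc)
  moreover have "l (x - y) = 0" if "l x + b = 0" "l y + b = 0" for x y
    using that by (metis add_right_cancel linear_diff[OF l] right_minus_eq)
  ultimately show ?thesis unfolding minkowski_diff_def ker_def by auto
qed

text \<open>One point of \<open>S\<close> already translates \<open>ker l\<close> onto the whole
  zero set, and further zeros add nothing new. With \<open>S = C \<inter> D\<close> this yields the
  Minkowski sum of the theorem.\<close>

lemma ker_affine_eq_sum:
  assumes l: "linear l" and "S \<noteq> {}" "S \<subseteq> ker (\<lambda>x. l x + b)"
  shows "ker (\<lambda>x. l x + b) = ker l + S"
proof
  obtain e where e: "e \<in> S" using assms(2) by blast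
  then have le: "l e + b = 0" using assms(3) by (auto simp: ker_def)
  show "ker (\<lambda>x. l x + b) \<subseteq> ker l + S"
  proof
    fix x assume "x \<in> ker (\<lambda>x. l x + b)"
    then have "l (x - e) = 0"
      using le by (simp add: ker_def linear_diff[OF l]) (metis add_right_cancel)
    then have "(x - e) + e \<in> ker l + S"
      using e by (intro set_plus_intro) (auto simp: ker_def)
    then show "x \<in> ker l + S" by simp
  qed
  show "ker l + S \<subseteq> ker (\<lambda>x. l x + b)"
    using assms(3) by (auto simp: ker_def linear_add[OF l] elim!: set_plus_elim)
qed

section \<open>Homogenisation of separating flats\<close>

text \<open>Affine maps on the space are the restrictions to height 1 of linear maps on its product
  with the reals. Comparing the two cones elementwise amounts to separating them by sign, as both
  contain 0.\<close>

lemma separating_flat_iff_separating_subspace: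
  fixes C D L :: "'x::real_vector set"
  shows "separating_flat C D L \<longleftrightarrow>
    (\<exists>U. separating_subspace (cone_of (C \<times> {1})) (cone_of (D \<times> {1})) U \<and> L = gamma1 -` U)"
    (is "_ \<longleftrightarrow> ?R")
proof
  assume "separating_flat C D L"
  then obtain l b and P :: "('x \<times> real) set" where l: "linear l"
    and P: "convex_cone P" "pointed P"
    and sep: "separates (\<lambda>x. l x + b) P C D" and L: "L = ker (\<lambda>x. l x + b)"
    unfolding separating_flat_def oriented_affine_def affine_map_def by blast
  define \<psi> where "\<psi> = (\<lambda>(x, t). l x + t *\<^sub>R b)"
  have psi: "linear \<psi>"
    unfolding \<psi>_def
    by (rule linearI) (auto simp: linear_add[OF l] linear_scale[OF l] algebra_simps)
  have K: "\<psi> k \<in> P" if "k \<in> cone_of (C \<times> {1})" for k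
    by (rule cone_of_image_subset[OF psi P(1) _ that])
      (use sep in \<open>auto simp: separates_def cone_le_def \<psi>_def\<close>)
  have G: "- \<psi> g \<in> P" if "g \<in> cone_of (D \<times> {1})" for g
    by (rule cone_of_image_subset[OF linear_compose_neg[OF psi] P(1) _ that])
      (use sep in \<open>auto simp: separates_def cone_le_def \<psi>_def\<close>)
  have "\<psi> k - \<psi> g \<in> P" if "k \<in> cone_of (C \<times> {1})" "g \<in> cone_of (D \<times> {1})" for k g
  proof -
    have "\<psi> k + - \<psi> g \<in> P"
      using K[OF that(1)] G[OF that(2)] P(1) unfolding convex_cone_iff by blast
    then show ?thesis by simp
  qed
  then have "separating_subspace (cone_of (C \<times> {1})) (cone_of (D \<times> {1})) (ker \<psi>)"
    using psi P by (intro separating_subspaceI) (auto simp: oriented_linear_def cone_le_def)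
  moreover have "L = gamma1 -` ker \<psi>"
    by (auto simp: L ker_def gamma1_def \<psi>_def)
  ultimately show ?R by blast
next
  assume ?R
  then obtain \<psi> and P :: "(('x \<times> real) \<times> real) set" where psi: "linear \<psi>"
    and P: "convex_cone P" "pointed P"
    and sep: "\<And>g k. g \<in> cone_of (D \<times> {1}) \<Longrightarrow> k \<in> cone_of (C \<times> {1}) \<Longrightarrow> \<psi> k - \<psi> g \<in> P"
    and L: "L = gamma1 -` ker \<psi>"
    unfolding separating_subspace_def oriented_linear_def cone_le_def by blast
  \<comment> \<open>The values at height 0 are the linear part of
    \<open>\<psi> \<circ> gamma1\<close>, and \<open>\<psi> (0, 1)\<close> is its constant
    term.\<close>
  have "linear (\<lambda>x. \<psi> (x, 0))"
    by (rule linearI)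
      (auto simp flip: linear_add[OF psi] linear_scale[OF psi])
  moreover have "\<psi> (x, 1) = \<psi> (x, 0) + \<psi> (0, 1)" for x
    by (simp flip: linear_add[OF psi])
  ultimately have "affine_map (\<psi> \<circ> gamma1)"
    unfolding affine_map_def gamma1_def comp_def by blast
  then have "oriented_affine (\<psi> \<circ> gamma1) P"
    using P by (simp add: oriented_affine_def)
  moreover have "separates (\<psi> \<circ> gamma1) P C D"
  proof -
    \<comment> \<open>The cone element 0 stands for \<open>k\<close> here and for \<open>g\<close>
      in the next claim, which splits the comparison into the two signs.\<close>
    have "- \<psi> (d, 1) \<in> P" if "d \<in> D" for d
      using sep[OF subset_cone_of zero_in_cone_of, of "(d, 1)"] that
      by (simp add: linear_0[OF psi])
    moreover have "\<psi> (c, 1) \<in> P" if "c \<in> C" for c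
      using sep[OF zero_in_cone_of subset_cone_of, of "(c, 1)"] that
      by (simp add: linear_0[OF psi])
    ultimately show ?thesis by (simp add: separates_def cone_le_def gamma1_def)
  qed
  ultimately have "separating_flat C D (ker (\<psi> \<circ> gamma1))"
    by (rule separating_flatI)
  then show "separating_flat C D L"
    by (simp add: L ker_def vimage_comp)
qed

section \<open>The criterion by supporting flats\<close>

text \<open>The separating map supports \<open>C\<close> and its negative, with the same kernel,
  supports \<open>D\<close>. If \<open>c - d\<close> lies in \<open>L - L\<close>, the values at
  \<open>c\<close> and \<open>d\<close> coincide, so they lie in both \<open>P\<close> and
  \<open>-P\<close> and are 0.\<close>

lemma separating_flat_imp_supporting_flats:
  fixes C D L :: "'x::real_vector set"
  assumes "separating_flat C D L" and meet: "C \<inter> D \<noteq> {}"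
  shows "supporting_flat C L" "supporting_flat D L"
    "\<And>c d. c \<in> C \<Longrightarrow> d \<in> D \<Longrightarrow> c - d \<in> minkowski_diff L L \<Longrightarrow> c \<in> L \<and> d \<in> L"
proof -
  obtain l b and P :: "('x \<times> real) set" where l: "linear l"
    and P: "convex_cone P" "pointed P"
    and sep: "separates (\<lambda>x. l x + b) P C D" and L: "L = ker (\<lambda>x. l x + b)"
    using assms(1) unfolding separating_flat_def oriented_affine_def affine_map_def by blast
  have C: "l c + b \<in> P" if "c \<in> C" for c
    using sep that by (simp add: separates_def cone_le_def)
  have D: "- (l d + b) \<in> P" if "d \<in> D" for d
    using sep that by (auto simp: separates_def cone_le_def)
  have "L \<noteq> {}" using assms not_separating_flat_empty by blast
  have "oriented_affine (\<lambda>x. l x + b) P"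
    using l P unfolding oriented_affine_def affine_map_def
    by (intro conjI exI[of _ l] exI[of _ b]) simp_all
  then show "supporting_flat C L"
    unfolding L by (rule supporting_flatI) (use C in \<open>auto simp: positive_on_def\<close>)
  have "affine_map (\<lambda>x. - (l x + b))"
    unfolding affine_map_def
    by (rule exI[of _ "\<lambda>x. - l x"], rule exI[of _ "- b"]) (simp add: linear_compose_neg[OF l])
  then have "oriented_affine (\<lambda>x. - (l x + b)) P"
    using P by (simp add: oriented_affine_def)
  then have "supporting_flat D (ker (\<lambda>x. - (l x + b)))"
    by (rule supporting_flatI) (use D in \<open>auto simp: positive_on_def\<close>)
  moreover have "ker (\<lambda>x. - (l x + b)) = L"
    unfolding L ker_def by (auto simp only: vimage_def mem_Collect_eq singleton_iff neg_equal_0_iff_equal)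
  ultimately show "supporting_flat D L" by simp
  fix c d assume cd: "c \<in> C" "d \<in> D" "c - d \<in> minkowski_diff L L"
  then have "l c = l d"
    using minkowski_diff_ker[OF l] \<open>L \<noteq> {}\<close> by (auto simp: L ker_def linear_diff[OF l])
  then have "l c + b = 0"
    using pointedD[OF P(2) C[OF cd(1)]] D[OF cd(2)] by simp
  then show "c \<in> L \<and> d \<in> L"
    using \<open>l c = l d\<close> by (simp add: L ker_def)
qed

text \<open>This is the face property of \<open>C \<inter> L\<close>: an affine map preserves convex
  combinations, and a combination of two elements of a pointed cone with positive weights is 0 only
  if both are.\<close>

lemma supporting_flat_face:
  assumes "supporting_flat C L" "x \<in> C" "y \<in> C" "s > 0" "t > 0" "s + t = 1"
    and z: "s *\<^sub>R x + t *\<^sub>R y \<in> L"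
  shows "x \<in> L \<and> y \<in> L"
proof -
  obtain l b and P :: "('a \<times> real) set" where l: "linear l"
    and P: "convex_cone P" "pointed P"
    and C: "\<And>c. c \<in> C \<Longrightarrow> l c + b \<in> P" and L: "L = ker (\<lambda>x. l x + b)"
    using assms(1) unfolding supporting_flat_def oriented_affine_def affine_map_def positive_on_def
    by blast
  have "s *\<^sub>R (l x + b) + t *\<^sub>R (l y + b) = l (s *\<^sub>R x + t *\<^sub>R y) + (s + t) *\<^sub>R b"
    by (simp add: linear_add[OF l] linear_scale[OF l] algebra_simps)
  also have "\<dots> = 0" using z \<open>s + t = 1\<close> by (simp add: L ker_def)
  finally show ?thesis
    using pointed_sum_zeroD[OF P C[OF assms(2)] C[OF assms(3)] assms(4,5)] by (simp add: L ker_def)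
qed

text \<open>Positivity of the affine map on \<open>C\<close> says nothing about its sign on
  \<open>D\<close>, hence the change of order. The support of \<open>D\<close> enters through the
  face property, which puts \<open>d\<close> in \<open>L\<close>.\<close>

lemma supporting_flats_imp_supporting_subspace:
  fixes C D L :: "'x::real_vector set"
  assumes convex: "convex C" "convex D" and meet: "C \<inter> D \<noteq> {}" and "L \<noteq> {}"
    and supp: "supporting_flat C L" "supporting_flat D L"
    and crit: "\<And>c d. c \<in> C \<Longrightarrow> d \<in> D \<Longrightarrow> c - d \<in> minkowski_diff L L \<Longrightarrow> c \<in> L \<and> d \<in> L"
  obtains L' where "supporting_subspace (cone_of (minkowski_diff C D)) L'" "L = L' + (C \<inter> D)"
proof -
  obtain l :: "'x \<Rightarrow> 'x \<times> real" and b where l: "linear l" and L: "L = ker (\<lambda>x. l x + b)"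
    using supp(1) unfolding supporting_flat_def oriented_affine_def affine_map_def by blast
  have LL: "minkowski_diff L L = ker l"
    using minkowski_diff_ker[OF l] \<open>L \<noteq> {}\<close> by (simp add: L)
  \<comment> \<open>Every cone that makes \<open>l\<close> positive on the generated cone contains
    this one, so it is the best candidate for being pointed.\<close>
  define Q where "Q = l ` cone_of (minkowski_diff C D)"
  have Q: "convex_cone Q"
    unfolding Q_def
    by (simp add: convex_cone_linear_image convex_cone_cone_of convex_minkowski_diff convex l)
  have QE: "\<exists>s c d. 0 \<le> s \<and> c \<in> C \<and> d \<in> D \<and> q = s *\<^sub>R (l c - l d)" if "q \<in> Q" for q
  proof -
    have "minkowski_diff C D \<noteq> {}" using meet by (auto simp: minkowski_diff_def)
    then have "q \<in> l ` {s *\<^sub>R x | s x. 0 \<le> s \<and> x \<in> minkowski_diff C D}"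
      using that by (simp add: Q_def cone_of_def)
    then obtain s c d where scd: "0 \<le> s" "c \<in> C" "d \<in> D" and "q = l (s *\<^sub>R (c - d))"
      unfolding minkowski_diff_def by blast
    then have "q = s *\<^sub>R (l c - l d)" by (simp only: linear_scale[OF l] linear_diff[OF l])
    with scd show ?thesis by blast
  qed
  have "q = 0" if q: "q \<in> Q" "- q \<in> Q" for q
  proof (rule ccontr)
    assume "q \<noteq> 0"
    obtain s c d where 1: "0 \<le> s" "c \<in> C" "d \<in> D" "q = s *\<^sub>R (l c - l d)"
      using QE[OF q(1)] by blast
    obtain t c' d' where 2: "0 \<le> t" "c' \<in> C" "d' \<in> D" "- q = t *\<^sub>R (l c' - l d')"
      using QE[OF q(2)] by blast
    have "s \<noteq> 0" "t \<noteq> 0" using \<open>q \<noteq> 0\<close> 1(4) 2(4) by auto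
    then have st: "s > 0" "t > 0" using 1(1) 2(1) by auto
    \<comment> \<open>These are \<open>s\<close> and \<open>t\<close> scaled to sum 1: convexity
      keeps the combinations in \<open>C\<close> and \<open>D\<close>, and \<open>l\<close> sends
      their difference to \<open>(q + (- q)) / (s + t) = 0\<close>.\<close>
    define u v where "u = s / (s + t)" and "v = t / (s + t)"
    have uv: "u > 0" "v > 0" "u + v = 1"
      using st by (auto simp: u_def v_def simp flip: add_divide_distrib)
    have "l ((u *\<^sub>R c + v *\<^sub>R c') - (u *\<^sub>R d + v *\<^sub>R d'))
        = u *\<^sub>R (l c - l d) + v *\<^sub>R (l c' - l d')"
      by (simp add: linear_add[OF l] linear_diff[OF l] linear_scale[OF l] algebra_simps)
    also have "\<dots> = (1 / (s + t)) *\<^sub>R (s *\<^sub>R (l c - l d) + t *\<^sub>R (l c' - l d'))"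
      by (simp add: u_def v_def scaleR_add_right)
    also have "\<dots> = 0" using 1(4) 2(4) by (simp flip: 1(4) 2(4))
    finally have "(u *\<^sub>R c + v *\<^sub>R c') - (u *\<^sub>R d + v *\<^sub>R d') \<in> minkowski_diff L L"
      by (simp add: LL ker_def)
    moreover have "u *\<^sub>R c + v *\<^sub>R c' \<in> C" "u *\<^sub>R d + v *\<^sub>R d' \<in> D"
      using convex 1 2 uv by (auto intro: convexD)
    ultimately have "u *\<^sub>R c + v *\<^sub>R c' \<in> L" "u *\<^sub>R d + v *\<^sub>R d' \<in> L"
      using crit by blast+
    then have "c \<in> L" "d \<in> L"
      using supporting_flat_face[OF supp(1) 1(2) 2(2) uv] supporting_flat_face[OF supp(2) 1(3) 2(3) uv]
      by blast+
    then have "l c = l d" unfolding L ker_def by (auto simp: add_eq_0_iff2)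
    then show False using 1(4) \<open>q \<noteq> 0\<close> by simp
  qed
  then have "pointed Q" using convex_cone_pointedI[OF Q] by blast
  then have "supporting_subspace (cone_of (minkowski_diff C D)) (ker l)"
    using l Q by (intro supporting_subspaceI[of l Q]) (auto simp: oriented_linear_def positive_on_def Q_def)
  \<comment> \<open>The criterion applies with \<open>c = d = e\<close>, since
    \<open>e - e = 0\<close> lies in \<open>L - L\<close>.\<close>
  moreover have "C \<inter> D \<subseteq> L"
  proof
    fix e assume "e \<in> C \<inter> D"
    then show "e \<in> L" using crit[of e e] by (simp add: LL ker_def linear_0[OF l])
  qed
  then have "L = ker l + (C \<inter> D)"
    using ker_affine_eq_sum[OF l meet] by (simp add: L)
  ultimately show ?thesis by (rule that)
qed

section \<open>Supporting subspaces of the cone of differences\<close>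

text \<open>The constant term cancels in differences, so a separating map has a linear part positive
  on \<open>C - D\<close>. Conversely, the constant is recovered by making the map vanish at a
  common point.\<close>

lemma separating_flat_iff_supporting_subspace_plus:
  fixes C D L :: "'x::real_vector set"
  assumes meet: "C \<inter> D \<noteq> {}"
  shows "separating_flat C D L \<longleftrightarrow>
    (\<exists>L'. supporting_subspace (cone_of (minkowski_diff C D)) L' \<and> L = L' + (C \<inter> D))"
    (is "_ \<longleftrightarrow> ?R")
proof
  assume "separating_flat C D L"
  then obtain l b and P :: "('x \<times> real) set" where l: "linear l"
    and P: "convex_cone P" "pointed P"
    and sep: "separates (\<lambda>x. l x + b) P C D" and L: "L = ker (\<lambda>x. l x + b)"
    unfolding separating_flat_def oriented_affine_def affine_map_def by blast
  have C: "l c + b \<in> P" if "c \<in> C" for c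
    using sep that by (simp add: separates_def cone_le_def)
  have D: "- (l d + b) \<in> P" if "d \<in> D" for d
    using sep that by (auto simp: separates_def cone_le_def)
  have "l (c - d) \<in> P" if "c \<in> C" "d \<in> D" for c d
  proof -
    have "(l c + b) + - (l d + b) \<in> P"
      using C[OF that(1)] D[OF that(2)] P(1) unfolding convex_cone_iff by blast
    then show ?thesis by (simp add: linear_diff[OF l])
  qed
  then have "l x \<in> P" if "x \<in> cone_of (minkowski_diff C D)" for x
    by (intro cone_of_image_subset[OF l P(1) _ that]) (auto simp: minkowski_diff_def)
  then have "supporting_subspace (cone_of (minkowski_diff C D)) (ker l)"
    using l P by (intro supporting_subspaceI[of l P]) (auto simp: oriented_linear_def positive_on_def)
  moreover have "C \<inter> D \<subseteq> L"
  proof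
    fix x assume "x \<in> C \<inter> D"
    then show "x \<in> L" using pointedD[OF P(2) C D] by (simp add: L ker_def)
  qed
  then have "L = ker l + (C \<inter> D)"
    using ker_affine_eq_sum[OF l meet] by (simp add: L)
  ultimately show ?R by blast
next
  assume ?R
  then obtain \<psi> and P :: "('x \<times> real) set" where psi: "linear \<psi>"
    and P: "convex_cone P" "pointed P"
    and pos: "\<And>x. x \<in> cone_of (minkowski_diff C D) \<Longrightarrow> \<psi> x \<in> P"
    and L: "L = ker \<psi> + (C \<inter> D)"
    unfolding supporting_subspace_def oriented_linear_def positive_on_def by blast
  have diff: "\<psi> c - \<psi> d \<in> P" if "c \<in> C" "d \<in> D" for c d
    using pos[OF subset_cone_of, of "c - d"] that
    by (auto simp: minkowski_diff_def linear_diff[OF psi])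
  \<comment> \<open>As \<open>e\<close> lies in both sets, \<open>\<psi> c - \<psi> e\<close> and
    \<open>\<psi> e - \<psi> d\<close> are values of \<open>\<psi>\<close> on \<open>C - D\<close>,
    so subtracting \<open>\<psi> e\<close> gives a separating map.\<close>
  obtain e where e: "e \<in> C" "e \<in> D" using meet by blast
  have "oriented_affine (\<lambda>x. \<psi> x + - \<psi> e) P"
    using psi P unfolding oriented_affine_def affine_map_def
    by (intro conjI exI[of _ \<psi>] exI[of _ "- \<psi> e"]) simp_all
  moreover have "separates (\<lambda>x. \<psi> x + - \<psi> e) P C D"
    using diff e by (simp add: separates_def cone_le_def)
  ultimately have "separating_flat C D (ker (\<lambda>x. \<psi> x + - \<psi> e))"
    by (rule separating_flatI)
  \<comment> \<open>Both \<open>x - e\<close> and \<open>e - x\<close> lie in \<open>C - D\<close>,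
    so pointedness makes \<open>\<psi>\<close> constant on \<open>C \<inter> D\<close>.\<close>
  moreover have "\<psi> x - \<psi> e = 0" if "x \<in> C \<inter> D" for x
    using pointedD[OF P(2), of "\<psi> x - \<psi> e"] diff[of x e] diff[of e x] e that by simp
  then have "C \<inter> D \<subseteq> ker (\<lambda>x. \<psi> x + - \<psi> e)" by (auto simp: ker_def)
  then have "ker (\<lambda>x. \<psi> x + - \<psi> e) = L"
    unfolding L by (rule ker_affine_eq_sum[OF psi meet])
  ultimately show "separating_flat C D L" by simp
qed

theorem theorem4p5:
  fixes C D L :: "'x::real_vector set"
  assumes "convex C" and "convex D" and "affine L"
  shows
    "((\<exists>U. separating_subspace (cone_of (C \<times> {1})) (cone_of (D \<times> {1})) U \<and> L = gamma1 -` U)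
        \<longleftrightarrow> separating_flat C D L) \<and>
     (C \<inter> D \<noteq> {} \<longrightarrow>
       (separating_flat C D L \<longleftrightarrow>
          L \<noteq> {} \<and> supporting_flat C L \<and> supporting_flat D L \<and>
          (\<forall>c\<in>C. \<forall>d\<in>D. c - d \<in> minkowski_diff L L \<longrightarrow> c \<in> L \<and> d \<in> L)) \<and>
       (separating_flat C D L \<longleftrightarrow>
          (\<exists>L'. supporting_subspace (cone_of (minkowski_diff C D)) L' \<and> L = L' + (C \<inter> D))))"
proof (intro conjI impI)
  show "(\<exists>U. separating_subspace (cone_of (C \<times> {1})) (cone_of (D \<times> {1})) U \<and> L = gamma1 -` U)
      \<longleftrightarrow> separating_flat C D L"
    using separating_flat_iff_separating_subspace by blast
  assume meet: "C \<inter> D \<noteq> {}"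
  note subspace = separating_flat_iff_supporting_subspace_plus[OF meet]
  show "separating_flat C D L \<longleftrightarrow>
      (\<exists>L'. supporting_subspace (cone_of (minkowski_diff C D)) L' \<and> L = L' + (C \<inter> D))"
    by (rule subspace)
  show "separating_flat C D L \<longleftrightarrow>
      L \<noteq> {} \<and> supporting_flat C L \<and> supporting_flat D L \<and>
      (\<forall>c\<in>C. \<forall>d\<in>D. c - d \<in> minkowski_diff L L \<longrightarrow> c \<in> L \<and> d \<in> L)" (is "_ \<longleftrightarrow> ?R")
  proof
    assume sep: "separating_flat C D L"
    then have "L \<noteq> {}" using not_separating_flat_empty[OF meet] by blast
    then show ?R using separating_flat_imp_supporting_flats[OF sep meet] by blast
  next
    \<comment> \<open>The way back to separation passes through the supporting subspace, whose
      translate is already known to be separating.\<close>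
    assume R: ?R
    then obtain L' where "supporting_subspace (cone_of (minkowski_diff C D)) L'" "L = L' + (C \<inter> D)"
      using supporting_flats_imp_supporting_subspace[OF assms(1,2) meet] by blast
    then show "separating_flat C D L" using subspace by blast
  qed
qed

end
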